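(* Let $\alpha,\beta>0$. There is a constant $C>0$ depending only on $\alpha$ and $\beta$ such that the following holds. Let $\delta\in(0,1)$, $t_n=n^{\delta/2}$, and let $\theta=(\theta_1,\dots,\theta_n)^{T}\in\mathbb{R}^n$ be distributed according to the hierarchical prior $$\theta_j\mid\tau\ \overset{\text{ind.}}{\sim}\ \mathrm{N}(0,\tau),\quad j=1,\dots,n,\qquad \tau\sim g,$$ where $g$ is the inverse-gamma $\mathrm{IG}(\alpha,\beta)$ distribution. Then $$\mathbb{P}(\|\theta\|_2<t_n)\le e^{-C\,n^{1-\delta}}.$$
   Context: $\|\cdot\|_2$ is the Euclidean norm. $\mathrm{N}(0,\tau)$ is the normal distribution with mean $0$ and variance $\tau$. The $\mathrm{IG}(\alpha,\beta)$ distribution on $(0,\infty)$ has density $g(\tau)=\frac{\beta^\alpha}{\Gamma(\alpha)}\tau^{-(1+\alpha)}e^{-\beta/\tau}$. This prior is the special case $\psi_j=1$ for all $j$ of a global-local (GL) prior, which is $\theta_j\mid\psi_j,\tau\sim \mathrm{N}(0,\psi_j\tau)$ independently, $\psi_j\sim f$ i.i.d., $\tau\sim g$. The probability is with respect to the marginal prior distribution of $\theta$. *)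

theory Defs
  imports "HOL-Probability.Probability"
begin

definition inverse_gamma_density :: "real \<Rightarrow> real \<Rightarrow> real \<Rightarrow> real" where
  "inverse_gamma_density \<alpha> \<beta> \<tau> =
    (if 0 < \<tau> then \<beta> powr \<alpha> / Gamma \<alpha> * \<tau> powr (- (1 + \<alpha>)) * exp (- \<beta> / \<tau>) else 0)"

definition inverse_gamma :: "real \<Rightarrow> real \<Rightarrow> real measure" where
  "inverse_gamma \<alpha> \<beta> = density lborel (inverse_gamma_density \<alpha> \<beta>)"

(* The second parameter is the variance, whereas that of normal_density is the
   standard deviation. *)
definition normal_dist :: "real \<Rightarrow> real \<Rightarrow> real measure" where
  "normal_dist \<mu> v = density lborel (normal_density \<mu> (sqrt v))"

definition conditional_prior :: "nat \<Rightarrow> real \<Rightarrow> (nat \<Rightarrow> real) measure" where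
  "conditional_prior n \<tau> = (\<Pi>\<^sub>M j\<in>{1..n}. normal_dist 0 \<tau>)"

(* The marginal law of \<theta>: the mixture of the conditional laws over \<tau>. The values
   \<tau> \<le> 0, where the conditional law is not meaningful, form a null set for \<tau>. *)
definition hierarchical_prior :: "real \<Rightarrow> real \<Rightarrow> nat \<Rightarrow> (nat \<Rightarrow> real) measure" where
  "hierarchical_prior \<alpha> \<beta> n = inverse_gamma \<alpha> \<beta> \<bind> conditional_prior n"

lemma inverse_gamma_density_nonneg [simp]:
  assumes "0 < \<alpha>" shows "0 \<le> inverse_gamma_density \<alpha> \<beta> \<tau>"
  using Gamma_real_pos[OF assms] by (auto simp: inverse_gamma_density_def)

lemma borel_measurable_inverse_gamma_density [measurable]:
  "inverse_gamma_density \<alpha> \<beta> \<in> borel_measurable borel"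
  unfolding inverse_gamma_density_def[abs_def] by measurable

lemma sets_inverse_gamma [simp, measurable_cong]: "sets (inverse_gamma \<alpha> \<beta>) = sets borel"
  and space_inverse_gamma [simp]: "space (inverse_gamma \<alpha> \<beta>) = UNIV"
  by (simp_all add: inverse_gamma_def)

lemma sets_normal_dist [simp, measurable_cong]: "sets (normal_dist \<mu> v) = sets borel"
  and space_normal_dist [simp]: "space (normal_dist \<mu> v) = UNIV"
  by (simp_all add: normal_dist_def)

lemma subprob_space_normal: "subprob_space (normal_dist \<mu> v)"
proof (cases "v = 0")
  case True
  then show ?thesis
    by (auto intro!: subprob_spaceI simp: normal_dist_def normal_density_def emeasure_density)
next
  case False
  have "normal_density \<mu> (sqrt v) = normal_density \<mu> (sqrt \<bar>v\<bar>)"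
    by (simp add: normal_density_def fun_eq_iff real_sqrt_abs flip: real_sqrt_power)
  with False show ?thesis
    by (simp add: normal_dist_def prob_space_normal_density prob_space_imp_subprob_space)
qed

lemma prob_space_normal: "0 < v \<Longrightarrow> prob_space (normal_dist \<mu> v)"
  by (simp add: normal_dist_def prob_space_normal_density)

lemma sets_conditional_prior [simp, measurable_cong]:
  "sets (conditional_prior n \<tau>) = sets (\<Pi>\<^sub>M j\<in>{1..n}. borel)"
  unfolding conditional_prior_def by (intro sets_PiM_cong) auto

lemma emeasure_conditional_prior_box:
  assumes "\<And>j. j \<in> {1..n} \<Longrightarrow> X j \<in> sets borel"
  shows "emeasure (conditional_prior n \<tau>) (\<Pi>\<^sub>E j\<in>{1..n}. X j) = (\<Prod>j\<in>{1..n}. emeasure (normal_dist 0 \<tau>) (X j))"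
proof -
  interpret N: subprob_space "normal_dist 0 \<tau>" by (rule subprob_space_normal)
  interpret product_sigma_finite "\<lambda>_::nat. normal_dist 0 \<tau>" ..
  show ?thesis unfolding conditional_prior_def using assms by (intro emeasure_PiM) auto
qed

lemma subprob_space_conditional_prior: "subprob_space (conditional_prior n \<tau>)"
proof
  have "space (conditional_prior n \<tau>) = (\<Pi>\<^sub>E j\<in>{1..n}. UNIV)"
    by (simp add: conditional_prior_def space_PiM)
  then show "emeasure (conditional_prior n \<tau>) (space (conditional_prior n \<tau>)) \<le> 1"
    using subprob_space.emeasure_space_le_1[OF subprob_space_normal[of 0 \<tau>]]
    by (simp add: emeasure_conditional_prior_box power_le_one del: One_nat_def)
  show "space (conditional_prior n \<tau>) \<noteq> {}"
    by (simp add: conditional_prior_def space_PiM PiE_eq_empty_iff)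
qed

lemma prob_space_conditional_prior: "0 < \<tau> \<Longrightarrow> prob_space (conditional_prior n \<tau>)"
  unfolding conditional_prior_def by (intro prob_space_PiM prob_space_normal)

lemma conditional_prior_kernel [measurable]:
  "conditional_prior n \<in> measurable borel (subprob_algebra (\<Pi>\<^sub>M j\<in>{1..n}. borel))"
proof -
  have [measurable]: "(\<lambda>\<tau>. emeasure (normal_dist 0 \<tau>) A) \<in> borel_measurable borel"
    if [measurable]: "A \<in> sets borel" for A
    unfolding normal_dist_def normal_density_def by (simp add: emeasure_density)
  show ?thesis
  proof (rule measurable_subprob_algebra_generated[OF sets_PiM Int_stable_prod_algebra prod_algebra_sets_into_space])
    fix A assume "A \<in> prod_algebra {1..n} (\<lambda>_. borel :: real measure)"
    then obtain X where "A = (\<Pi>\<^sub>E j\<in>{1..n}. X j)" "X \<in> (\<Pi> j\<in>{1..n}. sets borel)"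
      by (auto simp: prod_algebra_eq_finite)
    then show "(\<lambda>\<tau>. emeasure (conditional_prior n \<tau>) A) \<in> borel_measurable borel"
      by (auto simp: emeasure_conditional_prior_box Pi_iff simp del: One_nat_def
          intro!: borel_measurable_prod_ennreal)
  qed (auto simp: emeasure_conditional_prior_box simp del: One_nat_def
      intro: subprob_space_conditional_prior)
qed

lemma sets_hierarchical_prior [simp, measurable_cong]:
  "sets (hierarchical_prior \<alpha> \<beta> n) = sets (\<Pi>\<^sub>M j\<in>{1..n}. borel)"
  unfolding hierarchical_prior_def by (rule sets_bind) auto

lemma emeasure_hierarchical_prior:
  assumes "0 < \<alpha>" "A \<in> sets (\<Pi>\<^sub>M j\<in>{1..n}. borel)"
  shows "emeasure (hierarchical_prior \<alpha> \<beta> n) A =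
    (\<integral>\<^sup>+ \<tau>. ennreal (inverse_gamma_density \<alpha> \<beta> \<tau>) * emeasure (conditional_prior n \<tau>) A \<partial>lborel)"
  using assms unfolding hierarchical_prior_def
  by (subst emeasure_bind[where N = "\<Pi>\<^sub>M j\<in>{1..n}. borel"])
     (auto simp: inverse_gamma_def nn_integral_density simp del: One_nat_def
       intro: conditional_prior_kernel)

lemma prob_space_inverse_gamma:
  assumes "0 < \<alpha>" "0 < \<beta>"
  shows "prob_space (inverse_gamma \<alpha> \<beta>)"
proof
  let ?f = "\<lambda>t::real. t powr (\<alpha> - 1) / exp t"
  have img: "(\<lambda>\<tau>. \<beta> / \<tau>) ` {0<..} = {0<..}"
  proof (intro equalityI subsetI)
    fix y :: real assume "y \<in> {0<..}"
    then show "y \<in> (\<lambda>\<tau>. \<beta> / \<tau>) ` {0<..}"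
      using \<open>0 < \<beta>\<close> by (intro image_eqI[of _ _ "\<beta> / y"]) auto
  qed (use \<open>0 < \<beta>\<close> in auto)
  have "(?f has_integral Gamma \<alpha>) {0..}"
    using Gamma_integral_real[OF \<open>0 < \<alpha>\<close>] .
  then have hi: "(?f has_integral Gamma \<alpha>) {0<..}"
    by (subst has_integral_spike_set_eq[where T = "{0..}"]) (auto intro: negligible_subset[of "{0}"])
  then have "?f absolutely_integrable_on {0<..}"
    by (intro nonnegative_absolutely_integrable_1) auto
  with hi have "?f absolutely_integrable_on ((\<lambda>\<tau>. \<beta> / \<tau>) ` {0<..}) \<and> integral ((\<lambda>\<tau>. \<beta> / \<tau>) ` {0<..}) ?f = Gamma \<alpha>"
    by (simp add: img integral_unique)
  then have "(\<lambda>\<tau>. \<bar>- \<beta> / \<tau>\<^sup>2\<bar> * ?f (\<beta> / \<tau>)) absolutely_integrable_on {0<..} \<and>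
      integral {0<..} (\<lambda>\<tau>. \<bar>- \<beta> / \<tau>\<^sup>2\<bar> * ?f (\<beta> / \<tau>)) = Gamma \<alpha>"
    using \<open>0 < \<beta>\<close>
    by (subst has_absolute_integral_change_of_variables_1')
       (auto intro!: derivative_eq_intros inj_onI simp: power2_eq_square)
  then have "((\<lambda>\<tau>. \<bar>- \<beta> / \<tau>\<^sup>2\<bar> * ?f (\<beta> / \<tau>)) has_integral Gamma \<alpha>) {0<..}"
    using has_integral_iff set_lebesgue_integral_eq_integral(1) by blast
  then have "((\<lambda>\<tau>. 1 / Gamma \<alpha> * (\<bar>- \<beta> / \<tau>\<^sup>2\<bar> * ?f (\<beta> / \<tau>))) has_integral 1 / Gamma \<alpha> * Gamma \<alpha>) {0<..}"
    by (rule has_integral_mult_right)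
  moreover have "1 / Gamma \<alpha> * (\<bar>- \<beta> / \<tau>\<^sup>2\<bar> * ?f (\<beta> / \<tau>)) = inverse_gamma_density \<alpha> \<beta> \<tau>"
    if "\<tau> \<in> {0<..}" for \<tau>
    using that \<open>0 < \<beta>\<close>
    by (simp add: inverse_gamma_density_def powr_divide exp_minus powr_diff powr_minus powr_add
        power2_eq_square field_simps)
  ultimately have "(inverse_gamma_density \<alpha> \<beta> has_integral 1) {0<..}"
    using Gamma_real_pos[OF \<open>0 < \<alpha>\<close>] by (subst (asm) has_integral_cong) auto
  then have "(inverse_gamma_density \<alpha> \<beta> has_integral 1) UNIV"
    by (rule has_integral_on_superset) (auto simp: inverse_gamma_density_def)
  then have "(\<integral>\<^sup>+ \<tau>. ennreal (inverse_gamma_density \<alpha> \<beta> \<tau>) \<partial>lborel) = 1"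
    using nn_integral_has_integral_lebesgue[of UNIV "inverse_gamma_density \<alpha> \<beta>" 1] \<open>0 < \<alpha>\<close> by simp
  then show "emeasure (inverse_gamma \<alpha> \<beta>) (space (inverse_gamma \<alpha> \<beta>)) = 1"
    by (simp add: inverse_gamma_def emeasure_density)
qed

lemma prob_space_hierarchical_prior:
  assumes "0 < \<alpha>" "0 < \<beta>"
  shows "prob_space (hierarchical_prior \<alpha> \<beta> n)"
proof -
  interpret G: prob_space "inverse_gamma \<alpha> \<beta>" using assms by (rule prob_space_inverse_gamma)
  have "AE \<tau> in inverse_gamma \<alpha> \<beta>. 0 < \<tau>"
    unfolding inverse_gamma_def by (subst AE_density) (auto simp: inverse_gamma_density_def)
  then have "AE \<tau> in inverse_gamma \<alpha> \<beta>. prob_space (conditional_prior n \<tau>)"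
    by eventually_elim (rule prob_space_conditional_prior)
  then show ?thesis
    unfolding hierarchical_prior_def by (rule G.prob_space_bind) measurable
qed

end

theory Submission
  imports Defs
begin

text \<open>
  Conditionally on \<open>\<tau>\<close>, the exponential Markov inequality bounds the probability that
  \<open>\<parallel>\<theta>\<parallel>\<close> is less than \<open>t\<close> by \<open>\<rho>\<^sup>n\<close> with a constant \<open>\<rho> < 1\<close>, as soon as \<open>\<tau> \<ge> 2 t\<^sup>2 / n\<close>. For
  \<open>t\<^sup>2 = n powr \<delta>\<close> this threshold is \<open>2 / m\<close> with \<open>m = n powr (1 - \<delta>)\<close>, and the inverse-gamma law
  gives \<open>{..<2 / m}\<close> a mass that is exponentially small in \<open>m\<close>. This yields a bound
  \<open>A exp (- a m)\<close> with \<open>A > 1\<close>. To absorb the factor \<open>A\<close> when \<open>m\<close> is small, one uses that the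
  probability is also bounded by a constant less than \<open>1\<close>, because \<open>m \<ge> 1\<close> and
  the inverse-gamma law charges \<open>{2..}\<close>.
\<close>

text \<open>The extra factor doubles the exponent of the Gaussian, which leaves the density of
  variance \<open>v / 2\<close> up to normalisation. The ratio of the normalising constants is
  \<open>1 / sqrt 2\<close>, whatever \<open>v\<close> is.\<close>

lemma nn_integral_normal_exp_square:
  assumes "0 < v"
  shows "(\<integral>\<^sup>+x. ennreal (exp (- x\<^sup>2 / (2 * v))) \<partial>normal_dist 0 v) = ennreal (1 / sqrt 2)"
proof -
  have *: "normal_density 0 (sqrt v) x * exp (- x\<^sup>2 / (2 * v))
      = 1 / sqrt 2 * normal_density 0 (sqrt (v / 2)) x" for x
  proof -
    have "exp (- x\<^sup>2 / (2 * v)) * exp (- x\<^sup>2 / (2 * v)) = exp (- x\<^sup>2 / v)"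
      by (simp flip: exp_add)
    then show ?thesis
      using assms by (simp add: normal_density_def real_sqrt_mult field_simps)
  qed
  have "(\<integral>\<^sup>+x. ennreal (exp (- x\<^sup>2 / (2 * v))) \<partial>normal_dist 0 v)
      = (\<integral>\<^sup>+x. ennreal (1 / sqrt 2) * ennreal (normal_density 0 (sqrt (v / 2)) x) \<partial>lborel)"
    unfolding normal_dist_def
    by (subst nn_integral_density) (simp_all add: *[simplified] flip: ennreal_mult)
  also have "\<dots> = ennreal (1 / sqrt 2) * (\<integral>\<^sup>+x. ennreal (normal_density 0 (sqrt (v / 2)) x) \<partial>lborel)"
    by (rule nn_integral_cmult) simp
  also have "(\<integral>\<^sup>+x. ennreal (normal_density 0 (sqrt (v / 2)) x) \<partial>lborel) = 1"
    using assms prob_space.emeasure_space_1[OF prob_space_normal_density[of "sqrt (v / 2)" 0]]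
    by (simp add: emeasure_density)
  finally show ?thesis by simp
qed

lemma emeasure_conditional_prior_small_norm:
  fixes t \<tau> :: real
  assumes "0 < \<tau>" "0 \<le> t" "2 * t\<^sup>2 \<le> n * \<tau>"
  shows "emeasure (conditional_prior n \<tau>) {\<theta> \<in> space (conditional_prior n \<tau>). L2_set \<theta> {1..n} < t}
    \<le> ennreal ((exp (1 / 4) / sqrt 2) ^ n)"
    (is "emeasure ?M ?A \<le> _")
proof -
  interpret N: prob_space "normal_dist 0 \<tau>" using assms(1) by (rule prob_space_normal)
  interpret product_sigma_finite "\<lambda>_::nat. normal_dist 0 \<tau>" ..
  let ?f = "\<lambda>x. ennreal (exp (- x\<^sup>2 / (2 * \<tau>)))"
  have A: "?A \<in> sets ?M"
    unfolding L2_set_def by measurable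
  have "indicator ?A \<theta> \<le> ennreal (exp (n / 4)) * (\<Prod>j\<in>{1..n}. ?f (\<theta> j))" for \<theta>
  proof (cases "\<theta> \<in> ?A")
    case True
    let ?S = "\<Sum>j\<in>{1..n}. (\<theta> j)\<^sup>2"
    have "?S = (L2_set \<theta> {1..n})\<^sup>2"
      by (simp add: L2_set_def sum_nonneg)
    also have "\<dots> \<le> t\<^sup>2"
      using True by (intro power_mono) auto
    \<comment> \<open>On the event, \<open>?S / (2 * \<tau>)\<close> is at most
      \<open>t\<^sup>2 / (2 * \<tau>)\<close>, hence at most \<open>n / 4\<close> by the assumption
      on \<open>\<tau>\<close>.\<close>
    finally have "1 \<le> exp (n / 4 - ?S / (2 * \<tau>))"
      using assms by (simp add: field_simps)
    also have "\<dots> = exp (n / 4) * (\<Prod>j\<in>{1..n}. exp (- (\<theta> j)\<^sup>2 / (2 * \<tau>)))"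
    proof -
      have "(\<Prod>j\<in>{1..n}. exp (- (\<theta> j)\<^sup>2 / (2 * \<tau>))) = exp (- ?S / (2 * \<tau>))"
        by (simp add: sum_divide_distrib sum_negf flip: exp_sum)
      then show ?thesis by (simp flip: exp_add)
    qed
    finally show ?thesis
      using True by (simp add: prod_ennreal prod_nonneg flip: ennreal_mult)
  qed simp
  then have "emeasure ?M ?A \<le> (\<integral>\<^sup>+\<theta>. ennreal (exp (n / 4)) * (\<Prod>j\<in>{1..n}. ?f (\<theta> j)) \<partial>?M)"
    using A by (simp only: nn_integral_indicator[symmetric] nn_integral_mono)
  also have "\<dots> = ennreal (exp (n / 4)) * (\<integral>\<^sup>+\<theta>. (\<Prod>j\<in>{1..n}. ?f (\<theta> j)) \<partial>?M)"
    by (rule nn_integral_cmult) measurable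
  also have "(\<integral>\<^sup>+\<theta>. (\<Prod>j\<in>{1..n}. ?f (\<theta> j)) \<partial>?M) = ennreal (1 / sqrt 2) ^ n"
    unfolding conditional_prior_def
    by (subst product_nn_integral_prod) (simp_all add: nn_integral_normal_exp_square[OF assms(1), simplified])
  also have "ennreal (exp (n / 4)) * ennreal (1 / sqrt 2) ^ n = ennreal ((exp (1 / 4) / sqrt 2) ^ n)"
    by (simp add: ennreal_power power_divide flip: ennreal_mult exp_of_nat_mult)
  finally show ?thesis .
qed

text \<open>Comparing fourth powers reduces this to \<open>exp 1 < 4\<close>. It makes the
  conditional bound decay geometrically in \<open>n\<close>.\<close>

lemma exp_quarter_less_sqrt_2: "exp (1 / 4) / sqrt 2 < (1 :: real)"
proof -
  have "exp (1 / 4 :: real) ^ 4 = exp 1"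
    by (simp flip: exp_of_nat_mult)
  also have "\<dots> < 4"
    using exp_le by linarith
  also have "4 = sqrt 2 ^ 4"
    by (simp add: power4_eq_xxxx)
  finally have "exp (1 / 4) < sqrt (2 :: real)"
    by (rule power_less_imp_less_base) simp
  then show ?thesis by simp
qed

text \<open>The factor \<open>exp (- \<beta> / \<tau>)\<close> is split into two equal halves. For
  \<open>\<tau> < r\<close> one half is at most \<open>exp (- \<beta> / (2 * r))\<close>; the other
  turns the density into that of parameters \<open>\<alpha>\<close>, \<open>\<beta> / 2\<close>,
  whose total mass is 1. The ratio of the normalising constants is
  \<open>2 powr \<alpha>\<close>.\<close>

lemma inverse_gamma_left_tail:
  assumes "0 < \<alpha>" "0 < \<beta>" "0 < r"
  shows "measure (inverse_gamma \<alpha> \<beta>) {..<r} \<le> 2 powr \<alpha> * exp (- \<beta> / (2 * r))"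
proof -
  interpret G: prob_space "inverse_gamma \<alpha> \<beta>" using assms(1,2) by (rule prob_space_inverse_gamma)
  interpret H: prob_space "inverse_gamma \<alpha> (\<beta> / 2)"
    using assms by (intro prob_space_inverse_gamma) auto
  let ?c = "2 powr \<alpha> * exp (- \<beta> / (2 * r))"
  have *: "inverse_gamma_density \<alpha> \<beta> \<tau> \<le> ?c * inverse_gamma_density \<alpha> (\<beta> / 2) \<tau>" if "\<tau> < r" for \<tau>
  proof (cases "0 < \<tau>")
    case True
    have "exp (- \<beta> / \<tau>) = exp (- (\<beta> / 2) / \<tau>) * exp (- (\<beta> / 2) / \<tau>)"
      by (simp flip: exp_add)
    also have "\<dots> \<le> exp (- \<beta> / (2 * r)) * exp (- (\<beta> / 2) / \<tau>)"
      using that True assms by (intro mult_right_mono) (auto simp: field_simps)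
    finally have "\<beta> powr \<alpha> / Gamma \<alpha> * \<tau> powr (- (1 + \<alpha>)) * exp (- \<beta> / \<tau>)
        \<le> \<beta> powr \<alpha> / Gamma \<alpha> * \<tau> powr (- (1 + \<alpha>)) * (exp (- \<beta> / (2 * r)) * exp (- (\<beta> / 2) / \<tau>))"
      using Gamma_real_pos[OF assms(1)] by (intro mult_left_mono) auto
    also have "\<dots> = ?c * inverse_gamma_density \<alpha> (\<beta> / 2) \<tau>"
      using True assms by (simp add: inverse_gamma_density_def powr_divide)
    finally show ?thesis using True by (simp add: inverse_gamma_density_def)
  qed (simp add: inverse_gamma_density_def)
  have "emeasure (inverse_gamma \<alpha> \<beta>) {..<r}
      = (\<integral>\<^sup>+\<tau>. ennreal (inverse_gamma_density \<alpha> \<beta> \<tau>) * indicator {..<r} \<tau> \<partial>lborel)"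
    unfolding inverse_gamma_def by (subst emeasure_density) auto
  also have "\<dots> \<le> (\<integral>\<^sup>+\<tau>. ennreal ?c * ennreal (inverse_gamma_density \<alpha> (\<beta> / 2) \<tau>) \<partial>lborel)"
    using * assms(1)
    by (intro nn_integral_mono) (auto simp: indicator_def simp flip: ennreal_mult intro!: ennreal_leI)
  also have "\<dots> = ennreal ?c * (\<integral>\<^sup>+\<tau>. ennreal (inverse_gamma_density \<alpha> (\<beta> / 2) \<tau>) \<partial>lborel)"
    by (rule nn_integral_cmult) simp
  also have "(\<integral>\<^sup>+\<tau>. ennreal (inverse_gamma_density \<alpha> (\<beta> / 2) \<tau>) \<partial>lborel) = 1"
    using H.emeasure_space_1 by (simp add: inverse_gamma_def emeasure_density)
  finally show ?thesis
    by (simp add: G.emeasure_eq_measure)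
qed

text \<open>The density is positive on the whole half-line, so full mass below \<open>r\<close>
  would make an interval beyond \<open>r\<close> Lebesgue-null.\<close>

lemma inverse_gamma_lessThan_less_1:
  assumes "0 < \<alpha>" "0 < \<beta>"
  shows "measure (inverse_gamma \<alpha> \<beta>) {..<r} < 1"
proof (rule ccontr)
  interpret G: prob_space "inverse_gamma \<alpha> \<beta>" using assms by (rule prob_space_inverse_gamma)
  assume "\<not> ?thesis"
  then have "G.prob {..<r} = 1"
    using G.prob_le_1[of "{..<r}"] by linarith
  then have "AE \<tau> in inverse_gamma \<alpha> \<beta>. \<tau> < r"
    by (subst (asm) G.prob_eq_1) auto
  then have "AE \<tau> in lborel. 0 < inverse_gamma_density \<alpha> \<beta> \<tau> \<longrightarrow> \<tau> < r"
    unfolding inverse_gamma_def by (subst (asm) AE_density) auto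
  \<comment> \<open>The maximum with 1 keeps the interval inside the positive reals even if
    \<open>r\<close> is negative.\<close>
  then have "AE \<tau> in lborel. \<tau> \<notin> {max 1 r<..<max 1 r + 1}"
    by eventually_elim (use assms Gamma_real_pos[OF assms(1)] in
      \<open>auto simp: inverse_gamma_density_def split: if_splits\<close>)
  then have "emeasure lborel {max 1 r<..<max 1 r + 1} = 0"
    by (subst (asm) AE_iff_null_sets[symmetric]) (auto dest: null_setsD1)
  then show False by simp
qed

text \<open>The mixture is split at the threshold where the conditional bound starts to apply; below
  it the conditional probability is bounded by 1. Keeping the weight \<open>1 - h\<close> makes the
  bound a convex combination of 1 and a power of a number below 1, hence less than 1 whenever
  \<open>h < 1\<close>.\<close>

lemma hierarchical_prior_small_norm:
  fixes t :: real
  assumes "0 < \<alpha>" "0 < \<beta>" "0 < n" "0 \<le> t"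
  defines "h \<equiv> measure (inverse_gamma \<alpha> \<beta>) {..<2 * t\<^sup>2 / n}"
  shows "measure (hierarchical_prior \<alpha> \<beta> n)
      {\<theta> \<in> space (hierarchical_prior \<alpha> \<beta> n). L2_set \<theta> {1..n} < t}
    \<le> h + (exp (1 / 4) / sqrt 2) ^ n * (1 - h)"
    (is "measure ?H ?A \<le> h + ?q * (1 - h)")
proof -
  interpret G: prob_space "inverse_gamma \<alpha> \<beta>" using assms(1,2) by (rule prob_space_inverse_gamma)
  interpret H: prob_space ?H using assms(1,2) by (rule prob_space_hierarchical_prior)
  let ?r = "2 * t\<^sup>2 / n"
  let ?g = "\<lambda>\<tau>. ennreal (inverse_gamma_density \<alpha> \<beta> \<tau>)"
  have A: "?A \<in> sets (\<Pi>\<^sub>M j\<in>{1..n}. borel)"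
    unfolding sets_hierarchical_prior[symmetric, of n \<alpha> \<beta>] L2_set_def by measurable
  have space_eq: "space ?H = space (conditional_prior n \<tau>)" for \<tau>
    by (rule sets_eq_imp_space_eq) simp
  have *: "?g \<tau> * emeasure (conditional_prior n \<tau>) ?A
      \<le> ?g \<tau> * indicator {..<?r} \<tau> + ennreal ?q * (?g \<tau> * indicator {?r..} \<tau>)" for \<tau>
  proof -
    \<comment> \<open>For \<open>\<tau> \<le> 0\<close> the conditional law need not be a
      probability measure, but the density vanishes there.\<close>
    consider "\<tau> \<le> 0" | "0 < \<tau>" "\<tau> < ?r" | "0 < \<tau>" "?r \<le> \<tau>" by linarith
    then show ?thesis
    proof cases
      case 1
      then show ?thesis by (simp add: inverse_gamma_density_def)
    next
      case 2
      interpret P: prob_space "conditional_prior n \<tau>" using 2(1) by (rule prob_space_conditional_prior)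
      have "?g \<tau> * emeasure (conditional_prior n \<tau>) ?A \<le> ?g \<tau> * 1"
        by (intro mult_left_mono P.measure_le_1) simp
      then show ?thesis using 2 by simp
    next
      case 3
      have "emeasure (conditional_prior n \<tau>) ?A \<le> ennreal ?q"
        unfolding space_eq[of \<tau>] using 3 assms
        by (intro emeasure_conditional_prior_small_norm) (auto simp: field_simps)
      then show ?thesis using 3 by (simp add: mult.commute[of "ennreal ?q"] mult_left_mono)
    qed
  qed
  have "emeasure ?H ?A = (\<integral>\<^sup>+\<tau>. ?g \<tau> * emeasure (conditional_prior n \<tau>) ?A \<partial>lborel)"
    using assms(1) A by (rule emeasure_hierarchical_prior)
  also have "\<dots> \<le> (\<integral>\<^sup>+\<tau>. ?g \<tau> * indicator {..<?r} \<tau> + ennreal ?q * (?g \<tau> * indicator {?r..} \<tau>) \<partial>lborel)"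
    by (intro nn_integral_mono *)
  also have "\<dots> = (\<integral>\<^sup>+\<tau>. ?g \<tau> * indicator {..<?r} \<tau> \<partial>lborel)
      + ennreal ?q * (\<integral>\<^sup>+\<tau>. ?g \<tau> * indicator {?r..} \<tau> \<partial>lborel)"
    by (simp add: nn_integral_add nn_integral_cmult)
  also have "\<dots> = emeasure (inverse_gamma \<alpha> \<beta>) {..<?r} + ennreal ?q * emeasure (inverse_gamma \<alpha> \<beta>) {?r..}"
    by (simp add: inverse_gamma_def emeasure_density)
  also have "\<dots> = ennreal (h + ?q * G.prob {?r..})"
    by (simp add: G.emeasure_eq_measure h_def ennreal_mult)
  also have "G.prob {?r..} = 1 - h"
    using G.prob_compl[of "{..<?r}"] by (simp add: h_def Compl_eq_Diff_UNIV[symmetric])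
  finally have "ennreal (H.prob ?A) \<le> ennreal (h + ?q * (1 - h))"
    unfolding H.emeasure_eq_measure .
  then show ?thesis
    by (rule ennreal_le_iff[THEN iffD1, rotated]) (simp add: h_def)
qed

lemma exp_bound_absorb_constant:
  fixes A a q :: real
  assumes "1 < A" "0 < a" "q < 1"
  obtains C where "0 < C" "\<And>m p. 0 \<le> m \<Longrightarrow> p \<le> A * exp (- a * m) \<Longrightarrow> p \<le> q \<Longrightarrow> p \<le> exp (- C * m)"
proof
  \<comment> \<open>\<open>M\<close> solves \<open>A * exp (- a * M / 2) = 1\<close>: from there on,
    half of the rate pays for \<open>A\<close>.\<close>
  define M where "M = 2 * ln A / a"
  \<comment> \<open>The first term serves \<open>M \<le> m\<close>. The second gives
    \<open>C * m \<le> 1 - q\<close> for \<open>m < M\<close>, so that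
    \<open>q \<le> 1 - C * m \<le> exp (- C * m)\<close>.\<close>
  define C where "C = min (a / 2) ((1 - q) / M)"
  have M: "0 < M" using assms by (simp add: M_def)
  then show "0 < C" using assms by (simp add: C_def)
  fix m p :: real
  assume m: "0 \<le> m" and p: "p \<le> A * exp (- a * m)" "p \<le> q"
  show "p \<le> exp (- C * m)"
  proof (cases "M \<le> m")
    case True
    have "p \<le> exp (ln A - a * m)"
      using p assms by (simp add: exp_diff exp_minus field_simps)
    also have "\<dots> \<le> exp (- (a / 2) * m)"
      using True assms by (simp add: M_def field_simps)
    also have "\<dots> \<le> exp (- C * m)"
    proof -
      have "C * m \<le> a / 2 * m"
        using m by (intro mult_right_mono) (auto simp only: C_def min.cobounded1)
      then show ?thesis by simp
    qed
    finally show ?thesis .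
  next
    case False
    have "C * m \<le> (1 - q) / M * m"
      using m by (intro mult_right_mono) (simp_all add: C_def)
    also have "\<dots> \<le> (1 - q) / M * M"
      using False assms M by (intro mult_left_mono) auto
    finally have "C * m \<le> 1 - q" using M by simp
    then show ?thesis
      using p(2) exp_ge_add_one_self[of "- C * m"] by simp
  qed
qed

theorem theorem3p2:
  fixes \<alpha> \<beta> :: real
  assumes "0 < \<alpha>" and "0 < \<beta>"
  shows "\<exists>C>0. \<forall>\<delta>\<in>{0<..<1}. \<forall>n\<ge>1.
    measure (hierarchical_prior \<alpha> \<beta> n)
      {\<theta> \<in> space (hierarchical_prior \<alpha> \<beta> n). L2_set \<theta> {1..n} < real n powr (\<delta> / 2)}
    \<le> exp (- C * real n powr (1 - \<delta>))"
proof -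
  interpret G: prob_space "inverse_gamma \<alpha> \<beta>" using assms by (rule prob_space_inverse_gamma)
  define \<rho> :: real where "\<rho> = exp (1 / 4) / sqrt 2"
  have \<rho>: "0 < \<rho>" "\<rho> < 1"
    using exp_quarter_less_sqrt_2 by (simp_all add: \<rho>_def)
  define h where "h = (\<lambda>r. G.prob {..<r})"
  \<comment> \<open>The rate \<open>- ln \<rho>\<close> comes from \<open>\<rho> ^ n\<close>
    together with \<open>m \<le> n\<close>, and \<open>\<beta> / 4\<close> from the left tail at
    \<open>r = 2 / m\<close>.\<close>
  define a where "a = min (- ln \<rho>) (\<beta> / 4)"
  \<comment> \<open>This is the bound in the worst case \<open>n = 1\<close>, \<open>m = 1\<close>.
    Like \<open>a\<close>, it depends on \<open>\<alpha>\<close> and \<open>\<beta>\<close> only, so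
    \<open>C\<close> can be fixed before \<open>\<delta>\<close> and \<open>n\<close>.\<close>
  define q where "q = h 2 + \<rho> * (1 - h 2)"
  have h2: "h 2 < 1"
    using inverse_gamma_lessThan_less_1[OF assms] by (simp add: h_def)
  have "0 < a"
    using \<rho> assms by (simp add: a_def)
  moreover have "q < 1"
    using mult_pos_pos[of "1 - \<rho>" "1 - h 2"] \<rho> h2 by (simp add: q_def algebra_simps)
  ultimately obtain C where C: "0 < C"
    "\<And>m p. 0 \<le> m \<Longrightarrow> p \<le> (1 + 2 powr \<alpha>) * exp (- a * m) \<Longrightarrow> p \<le> q \<Longrightarrow> p \<le> exp (- C * m)"
    using exp_bound_absorb_constant[of "1 + 2 powr \<alpha>" a q] by auto
  show ?thesis
  proof (intro exI[of _ C] conjI ballI allI impI C)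
    fix \<delta> :: real and n :: nat
    assume \<delta>: "\<delta> \<in> {0<..<1}" and n: "1 \<le> n"
    define m where "m = real n powr (1 - \<delta>)"
    let ?p = "measure (hierarchical_prior \<alpha> \<beta> n)
      {\<theta> \<in> space (hierarchical_prior \<alpha> \<beta> n). L2_set \<theta> {1..n} < real n powr (\<delta> / 2)}"
    have m1: "1 \<le> m"
      using n \<delta> by (simp add: m_def ge_one_powr_ge_zero)
    have mn: "m \<le> n"
      using n \<delta> powr_mono[of "1 - \<delta>" 1 "real n"] by (simp add: m_def)
    show "0 \<le> m" using m1 by simp
    have "2 * (real n powr (\<delta> / 2))\<^sup>2 / n = 2 / m"
      using n by (simp add: m_def powr_diff power2_eq_square flip: powr_add)
    then have p: "?p \<le> h (2 / m) + \<rho> ^ n * (1 - h (2 / m))"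
      using hierarchical_prior_small_norm[OF assms, of n "real n powr (\<delta> / 2)"] n
      by (simp add: h_def \<rho>_def)
    have h01: "0 \<le> h (2 / m)" "h (2 / m) \<le> h 2"
      using m1 by (auto simp: h_def field_simps intro!: G.finite_measure_mono)
    have "\<rho> ^ n * (1 - h (2 / m)) \<le> \<rho> ^ n"
      using \<rho> h01 by (simp add: mult_left_le h_def)
    also have "\<dots> = exp (- (- ln \<rho>) * n)"
      using \<rho> by (simp add: exp_of_nat_mult mult.commute)
    also have "\<dots> \<le> exp (- a * m)"
    proof -
      have "a * m \<le> (- ln \<rho>) * n"
        using mn m1 \<rho> by (intro mult_mono) (auto simp: a_def)
      then show ?thesis by simp
    qed
    finally have 1: "\<rho> ^ n * (1 - h (2 / m)) \<le> exp (- a * m)" .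
    have "h (2 / m) \<le> 2 powr \<alpha> * exp (- \<beta> / (2 * (2 / m)))"
      unfolding h_def using assms m1 by (intro inverse_gamma_left_tail) auto
    also have "\<dots> \<le> 2 powr \<alpha> * exp (- a * m)"
      using m1 by (simp add: a_def min_mult_distrib_right)
    finally show "?p \<le> (1 + 2 powr \<alpha>) * exp (- a * m)"
      using p 1 by (simp add: algebra_simps)
    have "\<rho> ^ n \<le> \<rho>"
      using n \<rho> power_decreasing[of 1 n \<rho>] by simp
    then have "\<rho> ^ n * (1 - h (2 / m)) \<le> \<rho> * (1 - h (2 / m))"
      using h01 h2 by (intro mult_right_mono) auto
    \<comment> \<open>Since \<open>\<rho> < 1\<close>, the expression
      \<open>x + \<rho> * (1 - x)\<close> increases with \<open>x\<close>, so
      \<open>h (2 / m)\<close> may be replaced by \<open>h 2\<close>.\<close>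
    moreover have "(1 - \<rho>) * h (2 / m) \<le> (1 - \<rho>) * h 2"
      using h01 \<rho> by (intro mult_left_mono) auto
    ultimately show "?p \<le> q"
      using p by (simp add: q_def algebra_simps)
  qed
qed

end
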